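(* Let $\mathcal{H}$ be a separable complex Hilbert space and let $T$ be a bounded linear operator on $\mathcal{H}$ that is left-invertible and of finite index. Put $L_T=(T^*T)^{-1}T^*$. Then the following statements are equivalent: (1) $T=K+S$ for some compact operator $K$ and some isometry $S$ on $\mathcal{H}$. (2) $I-T^*T$ is compact. (3) $L_T-T^*$ is compact. (4) $I-TT^*$ is compact.
   Context: A bounded operator $T$ on $\mathcal{H}$ is left-invertible if there is a bounded operator $L$ on $\mathcal{H}$ with $LT=I$; in this case $T^*T$ is invertible, so $L_T$ is well defined (and is a left inverse of $T$). A bounded operator $T$ is semi-Fredholm if its range is closed and at least one of $\ker T$, $\ker T^*$ is finite-dimensional, and then its index is $\dim\ker T-\dim\ker T^*$. A left-invertible operator is injective with closed range, so it is semi-Fredholm, and "of finite index" means that $\dim\ker T^*<\infty$. An isometry on $\mathcal{H}$ is a bounded operator $S$ with $S^*S=I$. *)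

theory Defs
  imports "HOL-Analysis.Analysis" "HOL-Library.Extended_Nat"
begin

text \<open>
  Complex Hilbert spaces. The superclass \<^class>\<open>banach\<close> supplies the real scalar multiplication, the
  norm, its topology and completeness; the inner product is linear in the first argument.
\<close>

class complex_hilbert_space = banach +
  fixes scaleC :: "complex \<Rightarrow> 'a \<Rightarrow> 'a"  (infixr \<open>*\<^sub>C\<close> 75)
    and cinner :: "'a \<Rightarrow> 'a \<Rightarrow> complex"
  assumes scaleC_add_right: "a *\<^sub>C (x + y) = a *\<^sub>C x + a *\<^sub>C y"
    and scaleC_add_left: "(a + b) *\<^sub>C x = a *\<^sub>C x + b *\<^sub>C x"
    and scaleC_scaleC: "a *\<^sub>C b *\<^sub>C x = (a * b) *\<^sub>C x"
    and scaleC_of_real: "complex_of_real r *\<^sub>C x = r *\<^sub>R x"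
    and cinner_commute: "cinner x y = cnj (cinner y x)"
    and cinner_add_left: "cinner (x + y) z = cinner x z + cinner y z"
    and cinner_scaleC_left: "cinner (a *\<^sub>C x) y = a * cinner x y"
    and cinner_self: "cinner x x = complex_of_real ((norm x)\<^sup>2)"

global_interpretation cvec: vector_space "scaleC :: complex \<Rightarrow> 'a \<Rightarrow> 'a::complex_hilbert_space"
proof
  show "1 *\<^sub>C x = x" for x :: 'a
    using scaleC_of_real[of 1 x] by simp
qed (fact scaleC_add_right scaleC_add_left scaleC_scaleC)+

definition bounded_clinear :: "('a::complex_hilbert_space \<Rightarrow> 'a) \<Rightarrow> bool" where
  "bounded_clinear T \<longleftrightarrow> bounded_linear T \<and> (\<forall>c x. T (c *\<^sub>C x) = c *\<^sub>C T x)"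

text \<open>For bounded \<open>T\<close> the adjoint exists by the Riesz representation theorem.\<close>

definition adj :: "('a::complex_hilbert_space \<Rightarrow> 'a) \<Rightarrow> 'a \<Rightarrow> 'a" where
  "adj T = (THE T'. bounded_clinear T' \<and> (\<forall>x y. cinner (T x) y = cinner x (T' y)))"

lemma adj_eqI:
  assumes "bounded_clinear T'" "\<And>x y. cinner (T x) y = cinner x (T' y)"
  shows "adj T = T'"
  unfolding adj_def
proof (rule the_equality)
  fix S assume S: "bounded_clinear S \<and> (\<forall>x y. cinner (T x) y = cinner x (S y))"
  show "S = T'"
  proof
    fix y
    let ?d = "S y - T' y"
    have "cinner (S y) ?d = cinner (T' y) ?d"
      using S assms(2) by (metis cinner_commute)
    moreover have "cinner (?d + T' y) ?d = cinner ?d ?d + cinner (T' y) ?d"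
      by (rule cinner_add_left)
    ultimately have "cinner ?d ?d = 0" by simp
    then show "S y = T' y" by (simp add: cinner_self)
  qed
qed (use assms in blast)

definition left_invertible :: "('a::complex_hilbert_space \<Rightarrow> 'a) \<Rightarrow> bool" where
  "left_invertible T \<longleftrightarrow> bounded_clinear T \<and> (\<exists>L. bounded_clinear L \<and> L \<circ> T = id)"

definition ker :: "('a::complex_hilbert_space \<Rightarrow> 'a) \<Rightarrow> 'a set" where
  "ker T = {x. T x = 0}"

text \<open>The library's \<open>cvec.dim\<close> is \<open>0\<close> on infinite-dimensional subspaces; \<open>cdim\<close> is \<open>\<infinity>\<close> there.\<close>

definition cdim :: "'a::complex_hilbert_space set \<Rightarrow> enat" where
  "cdim V = (if \<exists>B. finite B \<and> V \<subseteq> cvec.span B then enat (cvec.dim V) else \<infinity>)"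

definition semi_fredholm :: "('a::complex_hilbert_space \<Rightarrow> 'a) \<Rightarrow> bool" where
  "semi_fredholm T \<longleftrightarrow>
     bounded_clinear T \<and> closed (range T) \<and> (cdim (ker T) < \<infinity> \<or> cdim (ker (adj T)) < \<infinity>)"

definition fredholm_index :: "('a::complex_hilbert_space \<Rightarrow> 'a) \<Rightarrow> ereal" where
  "fredholm_index T = ereal_of_enat (cdim (ker T)) - ereal_of_enat (cdim (ker (adj T)))"

definition finite_index :: "('a::complex_hilbert_space \<Rightarrow> 'a) \<Rightarrow> bool" where
  "finite_index T \<longleftrightarrow> semi_fredholm T \<and> \<bar>fredholm_index T\<bar> \<noteq> \<infinity>"

lemma closed_range_left_invertible:
  assumes "left_invertible T"
  shows "closed (range T)"
proof -
  obtain L where L: "bounded_linear L" "L \<circ> T = id" and T: "bounded_linear T"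
    using assms by (auto simp: left_invertible_def bounded_clinear_def)
  have "range T = {y. T (L y) = y}"
    using L(2) by (auto simp: fun_eq_iff) (metis rangeI)
  moreover have "continuous_on UNIV (\<lambda>y. T (L y))"
    by (intro linear_continuous_on bounded_linear_compose[OF T L(1)])
  ultimately show ?thesis
    by (simp add: closed_Collect_eq continuous_on_id)
qed

text \<open>For left-invertible operators, finite index means finite-dimensional cokernel.\<close>

lemma finite_index_left_invertible_iff:
  assumes "left_invertible T"
  shows "finite_index T \<longleftrightarrow> cdim (ker (adj T)) < \<infinity>"
proof -
  obtain L where L: "L \<circ> T = id" and T: "bounded_clinear T"
    using assms by (auto simp: left_invertible_def)
  have "T 0 = 0"
    using T by (simp add: bounded_clinear_def linear_simps)
  then have "ker T = {0}"
    using L by (auto simp: ker_def fun_eq_iff) metis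
  moreover have "cdim {0::'a} = 0"
  proof -
    have "{0::'a} \<subseteq> cvec.span {}" by simp
    moreover have "cvec.dim {0::'a} = 0"
      using cvec.dim_eq_card[of "{}" "{0::'a}"] cvec.independent_empty cvec.span_insert_0[of "{}"]
      by simp
    ultimately show ?thesis
      by (metis cdim_def finite.emptyI zero_enat_def)
  qed
  ultimately show ?thesis
    using T closed_range_left_invertible[OF assms]
    by (cases "cdim (ker (adj T))")
       (auto simp: finite_index_def semi_fredholm_def fredholm_index_def zero_ereal_def)
qed

definition isometry :: "('a::complex_hilbert_space \<Rightarrow> 'a) \<Rightarrow> bool" where
  "isometry S \<longleftrightarrow> bounded_clinear S \<and> adj S \<circ> S = id"

definition compact_operator :: "('a::complex_hilbert_space \<Rightarrow> 'a) \<Rightarrow> bool" where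
  "compact_operator K \<longleftrightarrow> bounded_clinear K \<and> (\<forall>B. bounded B \<longrightarrow> compact (closure (K ` B)))"

text \<open>The inverse below is meaningful for left-invertible \<open>T\<close>, where \<open>adj T \<circ> T\<close> is bijective.\<close>

definition canonical_left_inverse :: "('a::complex_hilbert_space \<Rightarrow> 'a) \<Rightarrow> 'a \<Rightarrow> 'a" where
  "canonical_left_inverse T = inv (adj T \<circ> T) \<circ> adj T"

end

theory Submission
  imports Defs
begin

text \<open>For \<open>T\<close> left-invertible, \<open>P = T\<^sup>*T\<close> is coercive, hence boundedly invertible, and
  \<open>L = P\<^sup>-\<^sup>1 T\<^sup>*\<close>. The equivalence of (2), (3) and (4) comes from \<open>L - T\<^sup>* = P\<^sup>-\<^sup>1 (I - P) T\<^sup>*\<close>,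
  \<open>(L - T\<^sup>*) T = I - P\<close>, \<open>L (I - T T\<^sup>*) = L - T\<^sup>*\<close> and \<open>I - T T\<^sup>* = (I - T L) + T (L - T\<^sup>*)\<close>, where
  \<open>I - T L\<close> has its range in the finite-dimensional kernel of \<open>T\<^sup>*\<close>. If \<open>T = K + S\<close>, then
  \<open>I - P = - (K\<^sup>* T + S\<^sup>* K)\<close>. Conversely, if \<open>I - P\<close> is compact, then so is the difference of \<open>T\<close> and
  its polar part.\<close>

subsection \<open>The inner product\<close>

lemma cinner_add_right: "cinner x (y + z) = cinner x y + cinner x z"
  by (metis cinner_commute cinner_add_left complex_cnj_add)

lemma cinner_scaleC_right: "cinner x (a *\<^sub>C y) = cnj a * cinner x y"
  by (metis cinner_commute cinner_scaleC_left complex_cnj_mult)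

lemma cinner_scaleR_left: "cinner (r *\<^sub>R x) y = r *\<^sub>R cinner x y"
  by (metis scaleC_of_real cinner_scaleC_left scaleR_conv_of_real)

lemma cinner_scaleR_right: "cinner x (r *\<^sub>R y) = r *\<^sub>R cinner x y"
  by (metis scaleC_of_real cinner_scaleC_right complex_cnj_complex_of_real scaleR_conv_of_real)

lemma Re_cinner_self: "Re (cinner x x) = (norm x)\<^sup>2"
  by (simp add: cinner_self)

lemma Re_cinner_commute: "Re (cinner x y) = Re (cinner y x)"
  by (metis cinner_commute complex_cnj(1) complex.sel(1) complex_surj)

lemma norm_add_square:
  "(norm (x + y))\<^sup>2 = (norm x)\<^sup>2 + 2 * Re (cinner x y) + (norm y)\<^sup>2"
  for x y :: "'a::complex_hilbert_space"
  using Re_cinner_commute[of x y]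
  by (simp flip: Re_cinner_self add: cinner_add_left cinner_add_right)

lemma norm_scaleC: "norm (a *\<^sub>C x) = cmod a * norm x"
proof -
  have "cinner (a *\<^sub>C x) (a *\<^sub>C x) = (a * cnj a) * cinner x x"
    by (simp add: cinner_scaleC_left cinner_scaleC_right)
  then have "complex_of_real ((norm (a *\<^sub>C x))\<^sup>2) = complex_of_real ((cmod a * norm x)\<^sup>2)"
    by (simp only: cinner_self complex_norm_square[symmetric] power_mult_distrib of_real_mult)
  then have "(norm (a *\<^sub>C x))\<^sup>2 = (cmod a * norm x)\<^sup>2"
    by (simp only: of_real_eq_iff)
  then show ?thesis
    by (rule power2_eq_imp_eq) auto
qed

text \<open>Squaring the triangle inequality, which is an axiom for the norm, and cancelling the
  square terms leaves the real form of Cauchy-Schwarz.\<close>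

lemma Re_cinner_le: "Re (cinner x y) \<le> norm x * norm y"
proof -
  have "(norm (x + y))\<^sup>2 \<le> (norm x + norm y)\<^sup>2"
    by (intro power_mono norm_triangle_ineq) simp
  then show ?thesis
    by (simp add: norm_add_square power2_sum)
qed

lemma norm_cinner_le: "cmod (cinner x y) \<le> norm x * norm y"
proof (cases "cinner x y = 0")
  case False
  \<comment> \<open>A unimodular factor turning \<open>cinner x y\<close> onto the nonnegative real
    axis, so that the bound on real parts controls the modulus.\<close>
  define a where "a = cnj (cinner x y) / cmod (cinner x y)"
  have "cinner (a *\<^sub>C x) y = cmod (cinner x y)"
    using False complex_norm_square[of "cinner x y"]
    by (simp add: cinner_scaleC_left a_def field_simps power2_eq_square)
  moreover have "norm (a *\<^sub>C x) = norm x"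
    using False by (simp add: norm_scaleC a_def norm_divide)
  ultimately show ?thesis
    using Re_cinner_le[of "a *\<^sub>C x" y] by simp
qed simp

interpretation cinner: bounded_bilinear cinner
  by standard
    (auto simp: cinner_add_left cinner_add_right cinner_scaleR_left cinner_scaleR_right
      intro!: exI[of _ 1] norm_cinner_le)

lemma cinner_extI:
  assumes "\<And>x. cinner x y = cinner x z"
  shows "y = z"
  using assms[of "y - z"]
  by (metis cinner.diff_right cinner_self eq_iff_diff_eq_0 norm_eq_zero of_real_eq_0_iff
      power_eq_0_iff)

subsection \<open>The Riesz representation theorem and adjoints\<close>

text \<open>The representing vector minimises \<open>\<parallel>x\<parallel>\<^sup>2 - 2 f x\<close>; minimising sequences are Cauchy by the
  parallelogram law.\<close>

lemma riesz_real:
  fixes f :: "'a::complex_hilbert_space \<Rightarrow> real"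
  assumes f: "bounded_linear f"
  shows "\<exists>z. \<forall>x. f x = Re (cinner x z)"
proof -
  interpret f: bounded_linear f by fact
  define J where "J x = (norm x)\<^sup>2 - 2 * f x" for x
  obtain M where M: "\<And>x. norm (f x) \<le> norm x * M"
    using f.bounded by blast
  have J_lower: "- M\<^sup>2 \<le> J x" for x
  proof -
    have "f x \<le> norm x * M" using M[of x] by simp
    moreover have "0 \<le> (norm x - M)\<^sup>2" by simp
    ultimately show ?thesis by (simp add: J_def power2_diff)
  qed
  define m where "m = Inf (range J)"
  have bdd: "bdd_below (range J)"
    using J_lower by (auto intro: bdd_belowI[of _ "- M\<^sup>2"])
  have m_le: "m \<le> J x" for x
    unfolding m_def by (rule cInf_lower[OF _ bdd]) simp
  have "\<exists>x. J x < m + 1 / Suc n" for n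
    using cInf_lessD[of "range J" "m + 1 / Suc n"] by (auto simp: m_def)
  then obtain X where X: "\<And>n. J (X n) < m + 1 / Suc n" by metis
  \<comment> \<open>The midpoint of \<open>x\<close> and \<open>y\<close> also has
    \<open>J\<close>-value at least \<open>m\<close>, so two near-minimisers cannot be far
    apart.\<close>
  have para: "(norm (x - y))\<^sup>2 \<le> 2 * (J x + J y - 2 * m)" for x y
  proof -
    have "(norm (x + y))\<^sup>2 + (norm (x - y))\<^sup>2 = 2 * (norm x)\<^sup>2 + 2 * (norm y)\<^sup>2"
      using norm_add_square[of x y] norm_add_square[of x "- y"]
      by (simp add: cinner.minus_right)
    moreover have "J ((1/2) *\<^sub>R (x + y)) = (norm (x + y))\<^sup>2 / 4 - (f x + f y)"
      by (simp add: J_def f.scaleR f.add power_divide add_divide_distrib)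
    ultimately have "J x + J y = 2 * J ((1/2) *\<^sub>R (x + y)) + (norm (x - y))\<^sup>2 / 2"
      by (simp add: J_def)
    then show ?thesis
      using m_le[of "(1/2) *\<^sub>R (x + y)"] by simp
  qed
  have "Cauchy X"
    unfolding Cauchy_iff
  proof (intro allI impI)
    fix e :: real assume "e > 0"
    \<comment> \<open>Two excesses over \<open>m\<close>, each below a quarter of the square of
      \<open>e\<close>, enter \<open>para\<close> with a factor 2.\<close>
    then obtain N where N: "1 / Suc N < e\<^sup>2 / 4"
      using reals_Archimedean[of "e\<^sup>2 / 4"] by (auto simp: inverse_eq_divide)
    have "norm (X a - X b) < e" if "N \<le> a" "N \<le> b" for a b
    proof -
      have "J (X a) < m + 1 / Suc N" "J (X b) < m + 1 / Suc N"
        using X[of a] X[of b] that frac_le[of 1 1 "Suc N" "Suc a"] frac_le[of 1 1 "Suc N" "Suc b"]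
        by (auto simp del: of_nat_Suc)
      then have "(norm (X a - X b))\<^sup>2 < e\<^sup>2"
        using para[of "X a" "X b"] N by simp
      then show ?thesis
        using \<open>e > 0\<close> by (auto dest: power2_less_imp_less)
    qed
    then show "\<exists>M. \<forall>m\<ge>M. \<forall>n\<ge>M. norm (X m - X n) < e" by blast
  qed
  then obtain z where z: "X \<longlonglongrightarrow> z"
    using Cauchy_convergent convergent_def by blast
  have "(\<lambda>n. J (X n)) \<longlonglongrightarrow> J z"
    unfolding J_def by (intro tendsto_intros f.tendsto z)
  moreover have "(\<lambda>n. m + 1 / Suc n) \<longlonglongrightarrow> m + 0"
    by (intro tendsto_intros LIMSEQ_Suc[OF lim_1_over_n])
  ultimately have "J z \<le> m + 0"
    by (rule LIMSEQ_le) (use X less_imp_le in blast)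
  then have Jz: "J z \<le> m" by simp
  have "f h = Re (cinner h z)" for h
  proof -
    \<comment> \<open>Half the derivative of \<open>J\<close> at the minimiser \<open>z\<close> in
      direction \<open>h\<close>; \<open>quad\<close> says that moving along \<open>h\<close> cannot
      decrease \<open>J\<close>.\<close>
    define d where "d = Re (cinner h z) - f h"
    have quad: "0 \<le> 2 * t * d + t\<^sup>2 * (norm h)\<^sup>2" for t
    proof -
      have "J z \<le> J (z + t *\<^sub>R h)" using Jz m_le order_trans by blast
      then show ?thesis
        using Re_cinner_commute[of z h]
        by (simp add: J_def norm_add_square f.add f.scaleR d_def cinner_scaleR_right
            power_mult_distrib algebra_simps)
    qed
    \<comment> \<open>The added 1 keeps \<open>s\<close> positive when \<open>h = 0\<close>. The
      choice \<open>t = - d / s\<close> in \<open>quad\<close> then bounds 0 by a negative multiple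
      of the square of \<open>d\<close>.\<close>
    define s where "s = (norm h)\<^sup>2 + 1"
    have s: "s > 0" by (simp add: s_def add_nonneg_pos)
    have "0 \<le> 2 * (- d / s) * d + (- d / s)\<^sup>2 * (norm h)\<^sup>2" by (rule quad)
    also have "\<dots> \<le> 2 * (- d / s) * d + (- d / s)\<^sup>2 * s"
      by (intro add_left_mono mult_left_mono) (auto simp: s_def)
    also have "\<dots> = - (d\<^sup>2 / s)"
      using s by (simp add: field_simps power2_eq_square)
    finally have "d = 0"
      using s by (simp add: divide_le_0_iff)
    then show ?thesis by (simp add: d_def)
  qed
  then show ?thesis by blast
qed

section \<open>Bounded complex-linear operators and their adjoints\<close>

lemma bounded_clinearI:
  assumes "\<And>x y. T (x + y) = T x + T y" "\<And>c x. T (c *\<^sub>C x) = c *\<^sub>C T x"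
    and "\<And>x. norm (T x) \<le> norm x * K"
  shows "bounded_clinear T"
proof -
  have "T (r *\<^sub>R x) = r *\<^sub>R T x" for r x
    by (metis assms(2) scaleC_of_real)
  then show ?thesis
    using assms by (auto simp: bounded_clinear_def intro: bounded_linear_intro[of _ K])
qed

lemma bounded_clinear_imp_bounded_linear: "bounded_clinear T \<Longrightarrow> bounded_linear T"
  by (simp add: bounded_clinear_def)

lemma bounded_clinear_scaleC: "bounded_clinear T \<Longrightarrow> T (c *\<^sub>C x) = c *\<^sub>C T x"
  by (simp add: bounded_clinear_def)

lemma scaleC_scaleR: "c *\<^sub>C r *\<^sub>R x = r *\<^sub>R c *\<^sub>C x"
  by (simp flip: scaleC_of_real add: scaleC_scaleC mult.commute)

lemma bounded_clinear_id: "bounded_clinear (\<lambda>x. x)"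
  and bounded_clinear_compose:
    "bounded_clinear F \<Longrightarrow> bounded_clinear G \<Longrightarrow> bounded_clinear (\<lambda>x. F (G x))"
  and bounded_clinear_add:
    "bounded_clinear F \<Longrightarrow> bounded_clinear G \<Longrightarrow> bounded_clinear (\<lambda>x. F x + G x)"
  and bounded_clinear_diff:
    "bounded_clinear F \<Longrightarrow> bounded_clinear G \<Longrightarrow> bounded_clinear (\<lambda>x. F x - G x)"
  and bounded_clinear_scaleR:
    "bounded_clinear F \<Longrightarrow> bounded_clinear (\<lambda>x. r *\<^sub>R F x)"
  by (auto simp: bounded_clinear_def bounded_linear_ident cvec.scale_right_diff_distrib
      scaleC_add_right bounded_linear_add bounded_linear_sub scaleC_scaleR
      intro: bounded_linear_compose bounded_linear_scaleR_right[THEN bounded_linear_compose])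

lemmas bounded_clinear_intros =
  bounded_clinear_id bounded_clinear_add bounded_clinear_diff bounded_clinear_scaleR

lemma adj_exists:
  assumes T: "bounded_clinear T"
  shows "\<exists>T'. bounded_clinear T' \<and> (\<forall>x y. cinner (T x) y = cinner x (T' y))"
proof -
  interpret T: bounded_linear T using T by (rule bounded_clinear_imp_bounded_linear)
  have "\<exists>z. \<forall>x. cinner (T x) y = cinner x z" for y
  proof -
    have "bounded_linear (\<lambda>x. Re (cinner (T x) y))"
      by (intro bounded_linear_compose[OF bounded_linear_Re]
          bounded_linear_compose[OF cinner.bounded_linear_left] T.bounded_linear)
    then obtain z where z: "\<And>x. Re (cinner (T x) y) = Re (cinner x z)"
      using riesz_real by blast
    \<comment> \<open>The real part of the form at \<open>\<i> *\<^sub>C x\<close> is minus the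
      imaginary part at \<open>x\<close>, so the real representation determines both.\<close>
    have "Im (cinner (T x) y) = Im (cinner x z)" for x
      using z[of "\<i> *\<^sub>C x"] by (simp add: bounded_clinear_scaleC[OF T] cinner_scaleC_left)
    then show ?thesis
      using z by (auto simp: complex_eq_iff)
  qed
  then obtain T' where T': "\<And>x y. cinner (T x) y = cinner x (T' y)" by metis
  obtain M where M: "\<And>x. norm (T x) \<le> norm x * M" "M > 0"
    using T.pos_bounded by blast
  have "bounded_clinear T'"
  proof (rule bounded_clinearI)
    show "T' (x + y) = T' x + T' y" for x y
      by (rule cinner_extI) (simp flip: T' add: cinner_add_right)
    show "T' (c *\<^sub>C x) = c *\<^sub>C T' x" for c x
      by (rule cinner_extI) (simp flip: T' add: cinner_scaleC_right)
    show "norm (T' x) \<le> norm x * M" for x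
    proof (cases "T' x = 0")
      case False
      have "(norm (T' x))\<^sup>2 = Re (cinner (T (T' x)) x)"
        by (simp add: T' Re_cinner_self)
      also have "\<dots> \<le> norm (T (T' x)) * norm x"
        by (rule Re_cinner_le)
      also have "\<dots> \<le> norm (T' x) * M * norm x"
        by (intro mult_right_mono M) simp
      finally show ?thesis
        using False by (simp add: power2_eq_square mult_ac)
    qed (use M in simp)
  qed
  then show ?thesis using T' by blast
qed

text \<open>Existence and uniqueness together identify the definite description in
  \<open>adj\<close>.\<close>

lemma bounded_clinear_adj: "bounded_clinear T \<Longrightarrow> bounded_clinear (adj T)"
  and cinner_adj_right: "bounded_clinear T \<Longrightarrow> cinner x (adj T y) = cinner (T x) y"
  using adj_exists adj_eqI by metis+

lemma cinner_adj_left: "bounded_clinear T \<Longrightarrow> cinner (adj T x) y = cinner x (T y)"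
  by (metis cinner_adj_right cinner_commute)

lemma adj_add:
  assumes F: "bounded_clinear F" and G: "bounded_clinear G"
  shows "adj (\<lambda>x. F x + G x) = (\<lambda>x. adj F x + adj G x)"
  by (rule adj_eqI)
    (auto simp: bounded_clinear_intros bounded_clinear_adj F G cinner_add_left cinner_add_right
      cinner_adj_right)

lemma isometryI:
  assumes S: "bounded_clinear S" and "\<And>x y. cinner (S x) (S y) = cinner x y"
  shows "isometry S"
proof -
  have "adj S (S x) = x" for x
    by (rule cinner_extI) (simp add: cinner_adj_right[OF S] assms(2))
  then show ?thesis
    using S by (auto simp: isometry_def)
qed

subsection \<open>Coercive operators\<close>

text \<open>The Lax-Milgram condition; taking the real part makes it meaningful without
  self-adjointness.\<close>

definition coercive :: "('a::complex_hilbert_space \<Rightarrow> 'a) \<Rightarrow> bool" where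
  "coercive A \<longleftrightarrow> (\<exists>c>0. \<forall>x. c * (norm x)\<^sup>2 \<le> Re (cinner (A x) x))"

definition self_adjoint :: "('a::complex_hilbert_space \<Rightarrow> 'a) \<Rightarrow> bool" where
  "self_adjoint A \<longleftrightarrow> (\<forall>x y. cinner (A x) y = cinner x (A y))"

lemma coercive_bounded_below:
  assumes "coercive A"
  shows "\<exists>c>0. \<forall>x. c * norm x \<le> norm (A x)"
proof -
  obtain c where c: "c > 0" "\<And>x. c * (norm x)\<^sup>2 \<le> Re (cinner (A x) x)"
    using assms by (auto simp: coercive_def)
  have "c * norm x \<le> norm (A x)" for x
  proof (cases "x = 0")
    case False
    have "c * norm x * norm x \<le> norm (A x) * norm x"
      using c(2)[of x] Re_cinner_le[of "A x" x] by (simp add: power2_eq_square mult_ac)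
    then show ?thesis using False by simp
  qed simp
  then show ?thesis using c by blast
qed

text \<open>Makes \<open>I + A\<close> invertible, so that it can be cancelled from
  \<open>(I - A) (I + A)\<close>.\<close>

lemma coercive_add_id:
  assumes "coercive A"
  shows "coercive (\<lambda>x. x + A x)"
proof -
  obtain c where c: "c > 0" "\<And>x. c * (norm x)\<^sup>2 \<le> Re (cinner (A x) x)"
    using assms by (auto simp: coercive_def)
  have "c * (norm x)\<^sup>2 \<le> Re (cinner (x + A x) x)" for x
    using c(2)[of x] by (simp add: cinner_add_left Re_cinner_self add_increasing)
  then show ?thesis using c by (auto simp: coercive_def)
qed

text \<open>Expanding the squared norm of \<open>x - t *\<^sub>R A x\<close>, coercivity makes the
  linear term in \<open>t\<close> negative, and for small \<open>t\<close> it outweighs the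
  quadratic one.\<close>

lemma coercive_contraction:
  assumes A: "bounded_clinear A" and "coercive A"
  shows "\<exists>t>0. \<exists>q. 0 \<le> q \<and> q < 1 \<and> (\<forall>x. norm (x - t *\<^sub>R A x) \<le> q * norm x)"
proof -
  obtain c where c: "c > 0" "\<And>x. c * (norm x)\<^sup>2 \<le> Re (cinner (A x) x)"
    using assms by (auto simp: coercive_def)
  obtain M0 where M0: "\<And>x. norm (A x) \<le> norm x * M0"
    using A bounded_linear.bounded by (fastforce simp: bounded_clinear_def)
  \<comment> \<open>The maximum ensures \<open>0 < M\<close> and \<open>c \<le> M\<close>, so the
    square root defining \<open>q\<close> has a nonnegative argument.\<close>
  define M where "M = max M0 c"
  have M: "norm (A x) \<le> norm x * M" for x
    using M0[of x] mult_left_mono[of M0 M "norm x"] by (simp add: M_def)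
  have "M > 0" "c \<le> M" using c by (auto simp: M_def)
  \<comment> \<open>The minimiser of \<open>1 - 2 * t * c + t\<^sup>2 * M\<^sup>2\<close>; the
    minimum is the square of \<open>q\<close>.\<close>
  define t where "t = c / M\<^sup>2"
  define q where "q = sqrt (1 - c\<^sup>2 / M\<^sup>2)"
  have "t > 0" using \<open>M > 0\<close> c by (simp add: t_def)
  have le1: "c\<^sup>2 / M\<^sup>2 \<le> 1" "0 < c\<^sup>2 / M\<^sup>2"
    using \<open>M > 0\<close> \<open>c \<le> M\<close> c(1) power_mono[of c M 2] by (auto simp: divide_le_eq_1)
  have q2: "q\<^sup>2 = 1 - c\<^sup>2 / M\<^sup>2" and "0 \<le> q" and "q < 1"
    using le1 by (auto simp: q_def)
  have "norm (x - t *\<^sub>R A x) \<le> q * norm x" for x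
  proof (rule power2_le_imp_le)
    have "(norm (x - t *\<^sub>R A x))\<^sup>2
        = (norm x)\<^sup>2 - 2 * t * Re (cinner (A x) x) + t\<^sup>2 * (norm (A x))\<^sup>2"
      using norm_add_square[of x "- (t *\<^sub>R A x)"] Re_cinner_commute[of x "A x"]
      by (simp add: cinner.minus_right cinner_scaleR_right power_mult_distrib)
    also have "\<dots> \<le> (norm x)\<^sup>2 - 2 * t * (c * (norm x)\<^sup>2) + t\<^sup>2 * (norm x * M)\<^sup>2"
      using \<open>t > 0\<close> by (intro add_mono diff_left_mono mult_left_mono power_mono c(2) M) auto
    also have "\<dots> = (1 - c\<^sup>2 / M\<^sup>2) * (norm x)\<^sup>2"
      using \<open>M > 0\<close> by (simp add: t_def field_simps power2_eq_square)
    also have "\<dots> = (q * norm x)\<^sup>2"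
      by (simp add: power_mult_distrib q2)
    finally show "(norm (x - t *\<^sub>R A x))\<^sup>2 \<le> (q * norm x)\<^sup>2" .
    show "0 \<le> q * norm x" using \<open>0 \<le> q\<close> by simp
  qed
  then show ?thesis using \<open>t > 0\<close> \<open>0 \<le> q\<close> \<open>q < 1\<close> by blast
qed

text \<open>Injectivity comes from the lower bound on \<open>norm (A x)\<close>. A solution of
  \<open>A x = y\<close> is a fixed point of the contraction
  \<open>x \<mapsto> x - t A x + t y\<close>.\<close>

lemma coercive_bij:
  assumes A: "bounded_clinear A" and co: "coercive A"
  shows "bij A"
proof (rule bijI)
  interpret A: bounded_linear A using A by (rule bounded_clinear_imp_bounded_linear)
  obtain c where c: "c > 0" "\<And>x. c * norm x \<le> norm (A x)"
    using coercive_bounded_below[OF co] by blast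
  show "inj A"
  proof (rule injI)
    fix x y assume "A x = A y"
    then have "c * norm (x - y) \<le> 0"
      using c(2)[of "x - y"] by (simp add: A.diff)
    then show "x = y" using c(1) by (simp add: mult_le_0_iff)
  qed
  obtain t q where tq: "t > 0" "0 \<le> q" "q < 1" "\<And>x. norm (x - t *\<^sub>R A x) \<le> q * norm x"
    using coercive_contraction[OF assms] by blast
  show "surj A"
    unfolding surj_def
  proof
    fix y
    have "\<exists>!x. x - t *\<^sub>R A x + t *\<^sub>R y = x"
    proof (rule banach_fix_type[OF tq(2,3)], intro allI)
      fix u v
      show "dist (u - t *\<^sub>R A u + t *\<^sub>R y) (v - t *\<^sub>R A v + t *\<^sub>R y) \<le> q * dist u v"
        using tq(4)[of "u - v"] by (simp add: dist_norm A.diff scaleR_diff_right algebra_simps)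
    qed
    then obtain x where "x - t *\<^sub>R A x + t *\<^sub>R y = x" by blast
    then have "t *\<^sub>R y = t *\<^sub>R A x" by (simp add: algebra_simps)
    then show "\<exists>x. y = A x" using tq(1) by auto
  qed
qed

lemma bounded_clinear_inv_coercive:
  assumes A: "bounded_clinear A" and co: "coercive A"
  shows "bounded_clinear (inv A)"
proof -
  interpret A: bounded_linear A using A by (rule bounded_clinear_imp_bounded_linear)
  have inj: "inj A" and AA: "\<And>x. A (inv A x) = x"
    using coercive_bij[OF assms] by (auto simp: bij_def surj_f_inv_f)
  obtain c where c: "c > 0" "\<And>x. c * norm x \<le> norm (A x)"
    using coercive_bounded_below[OF co] by blast
  show ?thesis
  proof (rule bounded_clinearI)
    show "inv A (x + y) = inv A x + inv A y" for x y
      by (rule inv_f_eq[OF inj]) (simp add: A.add AA)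
    show "inv A (a *\<^sub>C x) = a *\<^sub>C inv A x" for a x
      by (rule inv_f_eq[OF inj]) (simp add: bounded_clinear_scaleC[OF A] AA)
    show "norm (inv A x) \<le> norm x * (1 / c)" for x
      using c(2)[of "inv A x"] c(1) by (simp add: AA field_simps)
  qed
qed

text \<open>After rescaling, \<open>P = I - B\<close> with \<open>\<parallel>B\<parallel> < 1\<close>. Then \<open>(I - Y)\<^sup>2 = I - B\<close> means that \<open>Y\<close> is a
  fixed point of \<open>Y \<mapsto> (B + Y\<^sup>2) / 2\<close>, which is a contraction on a ball of radius less than 1.\<close>

lemma coercive_square_root:
  fixes P :: "'a::complex_hilbert_space \<Rightarrow> 'a"
  assumes P: "bounded_clinear P" "coercive P" and sa: "self_adjoint P"
  shows "\<exists>A. bounded_clinear A \<and> coercive A \<and> self_adjoint A \<and> (\<forall>x. A (A x) = P x)"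
proof -
  obtain t q where tq: "t > 0" "0 \<le> q" "q < 1" "\<And>x. norm (x - t *\<^sub>R P x) \<le> q * norm x"
    using coercive_contraction[OF P] by blast
  define B where "B = Blinfun (\<lambda>x. x - t *\<^sub>R P x)"
  have B: "blinfun_apply B x = x - t *\<^sub>R P x" for x
    unfolding B_def using P(1)
    by (subst bounded_linear_Blinfun_apply)
      (auto intro!: bounded_clinear_imp_bounded_linear bounded_clinear_intros)
  have norm_B: "norm B \<le> q"
    by (rule norm_blinfun_bound) (use tq in \<open>auto simp: B\<close>)
  \<comment> \<open>The smaller root of \<open>q + r * r = 2 * r\<close>: the ball of radius
    \<open>r\<close> is mapped into itself, and \<open>r\<close> also serves as the contraction
    constant.\<close>
  define r where "r = 1 - sqrt (1 - q)"
  have r: "0 \<le> r" "r < 1" and qr: "q + r * r = 2 * r"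
    using tq by (auto simp: r_def algebra_simps)
  \<comment> \<open>Symmetry is a closed condition preserved by \<open>f\<close>, so building it
    into the domain makes the fixed point self-adjoint.\<close>
  define s where "s = {Y :: 'a \<Rightarrow>\<^sub>L 'a. norm Y \<le> r \<and>
    (\<forall>x y. cinner (blinfun_apply Y x) y = cinner x (blinfun_apply Y y))}"
  define f where "f Y = (1/2) *\<^sub>R (B + (Y o\<^sub>L Y))" for Y :: "'a \<Rightarrow>\<^sub>L 'a"
  have "\<exists>!Y\<in>s. f Y = Y"
  proof (rule Banach_fix)
    have "closed s"
      unfolding s_def
      by (intro closed_Collect_conj closed_Collect_all closed_Collect_le closed_Collect_eq
          continuous_intros bounded_bilinear.continuous_on[OF cinner.bounded_bilinear_axioms])
    then show "complete s" by (simp add: complete_eq_closed)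
    show "s \<noteq> {}"
      using r by (auto simp: s_def cinner.zero_left cinner.zero_right intro!: exI[of _ 0])
    show "0 \<le> r" "r < 1" by fact+
    show "f ` s \<subseteq> s"
    proof clarify
      fix Y assume Y: "Y \<in> s"
      have "norm (Y o\<^sub>L Y) \<le> r * r"
        using Y r by (intro order_trans[OF norm_blinfun_compose] mult_mono) (auto simp: s_def)
      then have "norm (B + (Y o\<^sub>L Y)) \<le> 2 * r"
        using norm_B qr norm_triangle_ineq[of B "Y o\<^sub>L Y"] by linarith
      moreover have "cinner (f Y x) y = cinner x (f Y y)" for x y
        using Y sa
        by (simp add: s_def f_def self_adjoint_def B blinfun.bilinear_simps cinner_scaleR_left
            cinner_scaleR_right cinner_add_left cinner_add_right cinner.diff_left cinner.diff_right)
      ultimately show "f Y \<in> s" by (simp add: s_def f_def)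
    qed
    show "dist (f Y) (f Z) \<le> r * dist Y Z" if "Y \<in> s" "Z \<in> s" for Y Z
    proof -
      \<comment> \<open>This splitting does not require \<open>Y\<close> and \<open>Z\<close> to
        commute. Each summand has norm at most \<open>r * norm (Y - Z)\<close>, and the factor 1/2
        in \<open>f\<close> compensates for there being two.\<close>
      have "(Y o\<^sub>L Y) - (Z o\<^sub>L Z) = (Y o\<^sub>L (Y - Z)) + ((Y - Z) o\<^sub>L Z)"
        by (rule blinfun_eqI) (simp add: blinfun.bilinear_simps)
      moreover have "norm (Y o\<^sub>L (Y - Z)) \<le> r * norm (Y - Z)"
        using that by (intro order_trans[OF norm_blinfun_compose] mult_right_mono) (auto simp: s_def)
      moreover have "norm ((Y - Z) o\<^sub>L Z) \<le> norm (Y - Z) * r"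
        using that by (intro order_trans[OF norm_blinfun_compose] mult_left_mono) (auto simp: s_def)
      ultimately have "norm ((Y o\<^sub>L Y) - (Z o\<^sub>L Z)) \<le> 2 * (r * norm (Y - Z))"
        using norm_triangle_ineq[of "Y o\<^sub>L (Y - Z)" "(Y - Z) o\<^sub>L Z"] by (simp add: mult.commute)
      then show ?thesis
        by (simp add: f_def dist_norm flip: scaleR_diff_right)
    qed
  qed
  then obtain Y where Y: "norm Y \<le> r"
      "\<And>x y. cinner (blinfun_apply Y x) y = cinner x (blinfun_apply Y y)" and fY: "f Y = Y"
    by (auto simp: s_def)
  have YY: "Y (Y x) = 2 *\<^sub>R Y x - x + t *\<^sub>R P x" for x
  proof -
    have "2 *\<^sub>R f Y x = B x + Y (Y x)" by (simp add: f_def blinfun.bilinear_simps)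
    then show ?thesis by (simp add: fY B algebra_simps)
  qed
  \<comment> \<open>By \<open>YY\<close>, the square of \<open>I - Y\<close> is \<open>t P\<close>;
    dividing by \<open>sqrt t\<close> undoes the rescaling.\<close>
  define A where "A x = (1 / sqrt t) *\<^sub>R (x - Y x)" for x
  \<comment> \<open>The fixed point is a priori only real-linear; its symmetry for the complex inner
    product yields complex linearity.\<close>
  have Y_clinear: "bounded_clinear (blinfun_apply Y)"
  proof (rule bounded_clinearI)
    show "Y (c *\<^sub>C x) = c *\<^sub>C Y x" for c x
      by (rule cinner_extI) (simp flip: Y(2) add: cinner_scaleC_right)
    show "norm (Y x) \<le> norm x * norm Y" for x
      using norm_blinfun[of Y x] by (simp add: mult.commute)
  qed (simp add: blinfun.add_right)
  have "bounded_clinear A"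
    unfolding A_def by (intro bounded_clinear_intros Y_clinear)
  moreover have "coercive A"
  proof -
    have "(1 - r) / sqrt t * (norm x)\<^sup>2 \<le> Re (cinner (A x) x)" for x
    proof -
      have "Re (cinner (Y x) x) \<le> norm (Y x) * norm x" by (rule Re_cinner_le)
      also have "\<dots> \<le> (r * norm x) * norm x"
        using Y(1) by (intro mult_right_mono order_trans[OF norm_blinfun]) auto
      finally have "(1 - r) * (norm x)\<^sup>2 \<le> Re (cinner (x - Y x) x)"
        by (simp add: cinner.diff_left Re_cinner_self algebra_simps power2_eq_square)
      then show ?thesis
        using tq(1) by (simp add: A_def cinner_scaleR_left divide_right_mono)
    qed
    moreover have "(1 - r) / sqrt t > 0" using r tq by simp
    ultimately show ?thesis by (auto simp: coercive_def)
  qed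
  moreover have "self_adjoint A"
    by (simp add: self_adjoint_def A_def Y(2) cinner_scaleR_left cinner_scaleR_right
        cinner.diff_left cinner.diff_right)
  moreover have "A (A x) = P x" for x
    using tq(1)
    by (simp add: A_def blinfun.bilinear_simps YY algebra_simps scaleR_2 flip: scaleR_diff_right)
  ultimately show ?thesis by blast
qed

subsection \<open>Compact operators\<close>

text \<open>A closed subset of a compact set is compact, so enclosing the image is enough and
  closures need not be computed.\<close>

lemma compact_operatorI:
  assumes "bounded_clinear K" "\<And>B. bounded B \<Longrightarrow> \<exists>C. compact C \<and> K ` B \<subseteq> C"
  shows "compact_operator K"
  unfolding compact_operator_def
proof (intro conjI allI impI assms(1))
  fix B :: "'a set" assume "bounded B"
  then obtain C where C: "compact C" "K ` B \<subseteq> C" using assms(2) by blast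
  then have "closure (K ` B) \<subseteq> C" by (intro closure_minimal compact_imp_closed)
  then show "compact (closure (K ` B))"
    using compact_Int_closed[OF C(1) closed_closure] by (metis inf.absorb2)
qed

lemma compact_operatorD: "compact_operator K \<Longrightarrow> bounded B \<Longrightarrow> compact (closure (K ` B))"
  by (simp add: compact_operator_def)

lemma compact_operator_imp_bounded_clinear: "compact_operator K \<Longrightarrow> bounded_clinear K"
  by (simp add: compact_operator_def)

lemma compact_operator_add:
  assumes F: "compact_operator F" and G: "compact_operator G"
  shows "compact_operator (\<lambda>x. F x + G x)"
proof (rule compact_operatorI)
  show "bounded_clinear (\<lambda>x. F x + G x)"
    using F G by (intro bounded_clinear_intros compact_operator_imp_bounded_clinear)
  fix B :: "'a set" assume B: "bounded B"
  have "compact {u + v | u v. u \<in> closure (F ` B) \<and> v \<in> closure (G ` B)}"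
    by (intro compact_sums compact_operatorD B F G)
  moreover have "(\<lambda>x. F x + G x) ` B \<subseteq> {u + v | u v. u \<in> closure (F ` B) \<and> v \<in> closure (G ` B)}"
    using closure_subset[of "F ` B"] closure_subset[of "G ` B"] by blast
  ultimately show "\<exists>C. compact C \<and> (\<lambda>x. F x + G x) ` B \<subseteq> C" by (intro exI conjI)
qed

lemma compact_operator_compose_left:
  assumes F: "bounded_clinear F" and K: "compact_operator K"
  shows "compact_operator (\<lambda>x. F (K x))"
proof (rule compact_operatorI)
  show "bounded_clinear (\<lambda>x. F (K x))"
    using F K by (simp add: bounded_clinear_compose compact_operator_imp_bounded_clinear)
  fix B :: "'a set" assume B: "bounded B"
  have "compact (F ` closure (K ` B))"
    by (intro compact_continuous_image compact_operatorD B K linear_continuous_on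
        bounded_clinear_imp_bounded_linear F)
  moreover have "(\<lambda>x. F (K x)) ` B \<subseteq> F ` closure (K ` B)"
    using closure_subset by fast
  ultimately show "\<exists>C. compact C \<and> (\<lambda>x. F (K x)) ` B \<subseteq> C" by (intro exI conjI)
qed

lemma compact_operator_compose_right:
  assumes K: "compact_operator K" and F: "bounded_clinear F"
  shows "compact_operator (\<lambda>x. K (F x))"
proof (rule compact_operatorI)
  show "bounded_clinear (\<lambda>x. K (F x))"
    using F K by (simp add: bounded_clinear_compose compact_operator_imp_bounded_clinear)
  fix B :: "'a set" assume "bounded B"
  then have "bounded (F ` B)"
    by (rule bounded_linear_image) (rule bounded_clinear_imp_bounded_linear[OF F])
  then have "compact (closure (K ` F ` B))"
    by (rule compact_operatorD[OF K])
  then show "\<exists>C. compact C \<and> (\<lambda>x. K (F x)) ` B \<subseteq> C"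
    using closure_subset[of "K ` F ` B"] by (auto simp: image_image)
qed

lemma compact_operator_uminus:
  assumes "compact_operator K"
  shows "compact_operator (\<lambda>x. - K x)"
proof -
  have "bounded_clinear (\<lambda>x. - x :: 'a)"
    using bounded_clinear_scaleR[OF bounded_clinear_id, of "-1"] by simp
  then show ?thesis using assms by (rule compact_operator_compose_left)
qed

text \<open>Replacing the n-th point of a sequence in the closure by a point of \<open>S\<close>
  within \<open>1 / Suc n\<close> does not change subsequential limits. For adjoints this allows
  working with actual image points, which have preimages.\<close>

lemma compact_closure_sequentialI:
  fixes S :: "'a::metric_space set"
  assumes "\<And>f. (\<And>n. f n \<in> S) \<Longrightarrow> \<exists>l r. strict_mono (r :: nat \<Rightarrow> nat) \<and> (f \<circ> r) \<longlonglongrightarrow> l"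
  shows "compact (closure S)"
  unfolding compact_def
proof (intro allI impI)
  fix f :: "nat \<Rightarrow> 'a" assume f: "\<forall>n. f n \<in> closure S"
  then have "\<exists>y\<in>S. dist y (f n) < 1 / Suc n" for n
    by (auto simp: closure_approachable)
  then obtain g where g: "\<And>n. g n \<in> S" "\<And>n. dist (g n) (f n) < 1 / Suc n" by metis
  then obtain l r where r: "strict_mono r" "(g \<circ> r) \<longlonglongrightarrow> l"
    using assms by meson
  have lim0: "(\<lambda>n. 1 / Suc n + dist ((g \<circ> r) n) l) \<longlonglongrightarrow> 0 + 0"
    by (intro tendsto_add LIMSEQ_Suc[OF lim_1_over_n] r(2)[THEN tendsto_dist_iff[THEN iffD1]])
  have "norm (dist ((f \<circ> r) n) l) \<le> 1 / Suc n + dist ((g \<circ> r) n) l" for n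
  proof -
    have "dist (f (r n)) l \<le> dist (g (r n)) (f (r n)) + dist (g (r n)) l"
      by (rule dist_triangle3)
    moreover have "1 / Suc (r n) \<le> 1 / Suc n"
      using seq_suble[OF r(1), of n] by (intro divide_left_mono) auto
    ultimately show ?thesis using g(2)[of "r n"] by simp
  qed
  then have "(\<lambda>n. dist ((f \<circ> r) n) l) \<longlonglongrightarrow> 0"
    by (rule Lim_null_comparison[OF always_eventually[OF allI] lim0[unfolded add_0_left]])
  then have lim: "(f \<circ> r) \<longlonglongrightarrow> l" by (subst tendsto_dist_iff)
  have "l \<in> closure S"
    using closed_sequentially[OF closed_closure _ lim] f by simp
  then show "\<exists>l\<in>closure S. \<exists>r. strict_mono r \<and> (f \<circ> r) \<longlonglongrightarrow> l"
    using r(1) lim by blast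
qed

text \<open>The point is that \<open>\<parallel>K\<^sup>* z\<parallel>\<^sup>2 \<le> \<parallel>K K\<^sup>* z\<parallel> \<parallel>z\<parallel>\<close>, so that \<open>K\<^sup>*\<close> sends a bounded sequence to a
  Cauchy sequence whenever \<open>K K\<^sup>*\<close> does.\<close>

lemma compact_operator_adj:
  assumes K: "compact_operator K"
  shows "compact_operator (adj K)"
  unfolding compact_operator_def
proof (intro conjI allI impI)
  have bK: "bounded_clinear K" using K by (rule compact_operator_imp_bounded_clinear)
  then show bK': "bounded_clinear (adj K)" by (rule bounded_clinear_adj)
  interpret K: bounded_linear K using bK by (rule bounded_clinear_imp_bounded_linear)
  interpret K': bounded_linear "adj K" using bK' by (rule bounded_clinear_imp_bounded_linear)
  fix B :: "'a set" assume B: "bounded B"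
  then obtain M where M: "M > 0" "\<And>x. x \<in> B \<Longrightarrow> norm x \<le> M"
    by (auto simp: bounded_pos)
  have KK: "compact (closure ((\<lambda>x. K (adj K x)) ` B))"
    by (intro compact_operatorD[OF compact_operator_compose_right] K bK' B)
  \<comment> \<open>The inequality for \<open>z = x - y\<close>, where \<open>norm z\<close> is at
    most \<open>2 * M\<close>.\<close>
  have le: "(norm (adj K x - adj K y))\<^sup>2 \<le> 2 * M * norm (K (adj K x) - K (adj K y))"
    if "x \<in> B" "y \<in> B" for x y
  proof -
    have "(norm (adj K (x - y)))\<^sup>2 = Re (cinner (K (adj K (x - y))) (x - y))"
      using cinner_adj_right[OF bK] by (metis Re_cinner_self)
    also have "\<dots> \<le> norm (K (adj K (x - y))) * norm (x - y)"
      by (rule Re_cinner_le)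
    also have "\<dots> \<le> norm (K (adj K (x - y))) * (2 * M)"
      using M(2)[OF that(1)] M(2)[OF that(2)] norm_triangle_ineq4[of x y]
      by (intro mult_left_mono) auto
    finally show ?thesis by (simp add: K.diff K'.diff mult_ac)
  qed
  have "\<exists>l r. strict_mono r \<and> (f \<circ> r) \<longlonglongrightarrow> l" if f: "\<And>n. f n \<in> adj K ` B" for f :: "nat \<Rightarrow> 'a"
  proof -
    have "\<forall>n. \<exists>x. x \<in> B \<and> f n = adj K x" using f by blast
    then obtain g where g: "\<And>n. g n \<in> B" "\<And>n. f n = adj K (g n)" by metis
    have "\<And>n. K (adj K (g n)) \<in> closure ((\<lambda>x. K (adj K x)) ` B)"
      using g(1) by (auto intro!: closure_subset[THEN subsetD])
    then obtain l r where r: "strict_mono r" "((\<lambda>n. K (adj K (g n))) \<circ> r) \<longlonglongrightarrow> l"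
      using KK unfolding compact_def by meson
    have "Cauchy (f \<circ> r)"
      unfolding Cauchy_iff
    proof (intro allI impI)
      fix e :: real assume "e > 0"
      \<comment> \<open>The threshold at which \<open>le\<close> bounds the squared distance by the
        square of \<open>e\<close>.\<close>
      then have "e\<^sup>2 / (2 * M) > 0" using M(1) by simp
      then obtain N where N: "\<And>m n. m \<ge> N \<Longrightarrow> n \<ge> N \<Longrightarrow>
          norm (K (adj K (g (r m))) - K (adj K (g (r n)))) < e\<^sup>2 / (2 * M)"
        using LIMSEQ_imp_Cauchy[OF r(2)] unfolding Cauchy_iff by (metis comp_apply)
      have "norm ((f \<circ> r) m - (f \<circ> r) n) < e" if "m \<ge> N" "n \<ge> N" for m n
      proof (rule power2_less_imp_less)
        show "(norm ((f \<circ> r) m - (f \<circ> r) n))\<^sup>2 < e\<^sup>2"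
          using le[of "g (r m)" "g (r n)"] g N[OF that] M(1) by (simp add: field_simps)
      qed (use \<open>e > 0\<close> in simp)
      then show "\<exists>M. \<forall>m\<ge>M. \<forall>n\<ge>M. norm ((f \<circ> r) m - (f \<circ> r) n) < e" by blast
    qed
    then show ?thesis
      using r(1) by (auto simp: Cauchy_convergent_iff convergent_def)
  qed
  then show "compact (closure (adj K ` B))"
    by (rule compact_closure_sequentialI)
qed

section \<open>Orthonormal systems and operators of finite rank\<close>

definition orthonormal :: "'a::complex_hilbert_space set \<Rightarrow> bool" where
  "orthonormal E \<longleftrightarrow> (\<forall>x\<in>E. \<forall>y\<in>E. cinner x y = (if x = y then 1 else 0))"

lemma cinner_sum_orthonormal:
  assumes "finite E" "orthonormal E" "e \<in> E"
  shows "cinner (\<Sum>u\<in>E. c u *\<^sub>C u) e = c e"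
proof -
  have "cinner (\<Sum>u\<in>E. c u *\<^sub>C u) e = (\<Sum>u\<in>E. c u * cinner u e)"
    by (simp add: cinner.sum_left cinner_scaleC_left)
  also have "\<dots> = (\<Sum>u\<in>E. if u = e then c u else 0)"
    using assms by (intro sum.cong) (auto simp: orthonormal_def)
  finally show ?thesis using assms by simp
qed

lemma gram_schmidt:
  assumes "finite B"
  shows "\<exists>E. finite E \<and> orthonormal E \<and> cvec.span B \<subseteq> cvec.span E"
  using assms
proof (induction B)
  case empty
  show ?case by (rule exI[of _ "{}"]) (simp add: orthonormal_def)
next
  case (insert b B)
  then obtain E where E: "finite E" "orthonormal E" "cvec.span B \<subseteq> cvec.span E" by blast
  \<comment> \<open>The orthogonal projection of \<open>b\<close> onto the span of \<open>E\<close>;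
    the residual \<open>d\<close> is normalised and adjoined unless it vanishes.\<close>
  define p where "p = (\<Sum>u\<in>E. cinner b u *\<^sub>C u)"
  define d where "d = b - p"
  have p: "p \<in> cvec.span E"
    unfolding p_def by (intro cvec.span_sum cvec.span_scale cvec.span_base)
  have orth: "cinner d e = 0" if "e \<in> E" for e
    using cinner_sum_orthonormal[OF E(1,2) that] by (simp add: d_def p_def cinner.diff_left)
  define e where "e = (1 / norm d) *\<^sub>R d"
  show ?case
  proof (cases "d = 0")
    case True
    then have "b \<in> cvec.span E" using p by (simp add: d_def)
    then have "cvec.span (insert b B) \<subseteq> cvec.span E"
      using E(3) cvec.span_superset[of B] by (intro cvec.span_minimal cvec.subspace_span) auto
    then show ?thesis using E by blast
  next
    case False
    have "b = p + complex_of_real (norm d) *\<^sub>C e"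
      using False by (simp add: scaleC_of_real e_def d_def)
    then have "b \<in> cvec.span (insert e E)"
      using p cvec.span_mono[of E "insert e E"]
      by (auto intro!: cvec.span_add cvec.span_scale intro: cvec.span_base)
    moreover have "B \<subseteq> cvec.span (insert e E)"
      using E(3) cvec.span_superset[of B] cvec.span_mono[of E "insert e E"] by blast
    ultimately have "cvec.span (insert b B) \<subseteq> cvec.span (insert e E)"
      by (intro cvec.span_minimal cvec.subspace_span) auto
    moreover have "cinner e u = 0" "cinner u e = 0" if "u \<in> E" for u
      using orth[OF that] cinner_commute[of u e]
      by (simp_all add: e_def cinner_scaleR_left)
    moreover have "cinner e e = 1"
      using False by (simp add: cinner_self e_def)
    ultimately show ?thesis
      using E(1,2) by (intro exI[of _ "insert e E"]) (auto simp: orthonormal_def)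
  qed
qed

lemma orthonormal_expansion:
  assumes E: "finite E" "orthonormal E" and "y \<in> cvec.span E"
  shows "y = (\<Sum>e\<in>E. cinner y e *\<^sub>C e)"
proof -
  obtain c where c: "y = (\<Sum>u\<in>E. c u *\<^sub>C u)"
    using assms cvec.span_finite by auto
  have "cinner y e = c e" if "e \<in> E" for e
    unfolding c by (rule cinner_sum_orthonormal[OF E that])
  then show ?thesis using c by simp
qed

text \<open>The operator factors through the complex plane, where bounded sets have compact closure,
  followed by the continuous map \<open>c \<mapsto> c *\<^sub>C e\<close>.\<close>

lemma compact_operator_rank_one:
  assumes F: "bounded_clinear F"
  shows "compact_operator (\<lambda>x. cinner (F x) e *\<^sub>C e)"
proof (rule compact_operatorI)
  obtain M where M: "\<And>x. norm (F x) \<le> norm x * M"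
    using F bounded_linear.bounded by (fastforce simp: bounded_clinear_def)
  show "bounded_clinear (\<lambda>x. cinner (F x) e *\<^sub>C e)"
  proof (rule bounded_clinearI)
    interpret F: bounded_linear F using F by (rule bounded_clinear_imp_bounded_linear)
    show "cinner (F (x + y)) e *\<^sub>C e = cinner (F x) e *\<^sub>C e + cinner (F y) e *\<^sub>C e" for x y
      by (simp add: F.add cinner_add_left scaleC_add_left)
    show "cinner (F (c *\<^sub>C x)) e *\<^sub>C e = c *\<^sub>C cinner (F x) e *\<^sub>C e" for c x
      by (simp add: bounded_clinear_scaleC[OF F] cinner_scaleC_left scaleC_scaleC)
    show "norm (cinner (F x) e *\<^sub>C e) \<le> norm x * (M * norm e * norm e)" for x
    proof -
      have "norm (cinner (F x) e *\<^sub>C e) \<le> (norm (F x) * norm e) * norm e"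
        unfolding norm_scaleC by (intro mult_right_mono norm_cinner_le) simp
      also have "\<dots> \<le> (norm x * M * norm e) * norm e"
        by (intro mult_right_mono M) simp_all
      finally show ?thesis by (simp add: mult_ac)
    qed
  qed
  have "continuous_on UNIV (\<lambda>c. c *\<^sub>C e)"
  proof (rule linear_continuous_on, rule bounded_linear_intro)
    show "(a + b) *\<^sub>C e = a *\<^sub>C e + b *\<^sub>C e" for a b by (rule scaleC_add_left)
    show "(r *\<^sub>R a) *\<^sub>C e = r *\<^sub>R a *\<^sub>C e" for r a
      by (simp flip: scaleC_of_real add: scaleR_conv_of_real scaleC_scaleC)
    show "norm (a *\<^sub>C e) \<le> norm a * norm e" for a by (simp add: norm_scaleC)
  qed
  fix B :: "'a set" assume B: "bounded B"
  have "bounded ((\<lambda>x. cinner (F x) e) ` B)"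
    by (rule bounded_linear_image[OF B])
      (intro bounded_linear_compose[OF cinner.bounded_linear_left]
        bounded_clinear_imp_bounded_linear F)
  then have "compact ((\<lambda>c. c *\<^sub>C e) ` closure ((\<lambda>x. cinner (F x) e) ` B))"
    by (intro compact_continuous_image continuous_on_subset[OF \<open>continuous_on UNIV _\<close>])
      (auto simp: compact_closure)
  moreover have "(\<lambda>x. cinner (F x) e *\<^sub>C e) ` B
      \<subseteq> (\<lambda>c. c *\<^sub>C e) ` closure ((\<lambda>x. cinner (F x) e) ` B)"
    using closure_subset by fast
  ultimately show "\<exists>C. compact C \<and> (\<lambda>x. cinner (F x) e *\<^sub>C e) ` B \<subseteq> C"
    by (intro exI conjI)
qed

lemma compact_operator_zero: "compact_operator (\<lambda>x. 0)"
  by (rule compact_operatorI)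
    (auto intro!: bounded_clinearI[of _ 0] exI[of _ "{0}"])

lemma compact_operator_sum:
  assumes "finite I" "\<And>i. i \<in> I \<Longrightarrow> compact_operator (K i)"
  shows "compact_operator (\<lambda>x. \<Sum>i\<in>I. K i x)"
  using assms
proof (induction I)
  case empty
  show ?case by (simp add: compact_operator_zero)
next
  case (insert i I)
  then show ?case using compact_operator_add[of "K i" "\<lambda>x. \<Sum>i\<in>I. K i x"] by simp
qed

text \<open>Expanding \<open>F x\<close> in a finite orthonormal system whose span contains
  \<open>V\<close> writes \<open>F\<close> as a finite sum of operators of rank at most one.\<close>

lemma compact_operator_finite_rank:
  assumes F: "bounded_clinear F" and "range F \<subseteq> V" and "cdim V < \<infinity>"
  shows "compact_operator F"
proof -
  obtain B where "finite B" "V \<subseteq> cvec.span B"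
    using assms(3) by (auto simp: cdim_def split: if_splits)
  then obtain E where E: "finite E" "orthonormal E" "V \<subseteq> cvec.span E"
    using gram_schmidt[of B] by blast
  have "F = (\<lambda>x. \<Sum>e\<in>E. cinner (F x) e *\<^sub>C e)"
    using orthonormal_expansion[OF E(1,2)] E(3) assms(2) by blast
  moreover have "compact_operator (\<lambda>x. \<Sum>e\<in>E. cinner (F x) e *\<^sub>C e)"
    by (intro compact_operator_sum E compact_operator_rank_one F)
  ultimately show ?thesis by simp
qed

subsection \<open>Operators close to an isometry\<close>

text \<open>If \<open>M\<close> bounds a left inverse, then
  \<open>norm x \<le> M * norm (T x)\<close>, and the quadratic form of
  \<open>adj T \<circ> T\<close> is the square of \<open>norm (T x)\<close>.\<close>

lemma left_invertible_imp_coercive: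
  assumes "left_invertible T"
  shows "coercive (\<lambda>x. adj T (T x))"
proof -
  obtain L where T: "bounded_clinear T" and L: "bounded_clinear L" "\<And>x. L (T x) = x"
    using assms by (auto simp: left_invertible_def fun_eq_iff)
  obtain M where M: "M > 0" "\<And>x. norm (L x) \<le> norm x * M"
    using bounded_linear.pos_bounded[OF bounded_clinear_imp_bounded_linear[OF L(1)]] by blast
  have "1 / M\<^sup>2 * (norm x)\<^sup>2 \<le> Re (cinner (adj T (T x)) x)" for x
  proof -
    have "norm x \<le> norm (T x) * M" using M(2)[of "T x"] by (simp add: L(2))
    then have "(norm x)\<^sup>2 \<le> (norm (T x) * M)\<^sup>2" by (intro power_mono) auto
    then show ?thesis
      using M(1) by (simp add: cinner_adj_left[OF T] Re_cinner_self power_mult_distrib field_simps)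
  qed
  then show ?thesis
    using M(1) unfolding coercive_def by (intro exI[of _ "1 / M\<^sup>2"]) auto
qed

lemma compact_perturbation_of_isometry_imp:
  assumes K: "compact_operator K" and S: "isometry S"
  shows "compact_operator (\<lambda>x. x - adj (\<lambda>x. K x + S x) (K x + S x))"
proof -
  have bK: "bounded_clinear K" and bS: "bounded_clinear S" and SS: "\<And>x. adj S (S x) = x"
    using K S by (auto simp: isometry_def fun_eq_iff compact_operator_imp_bounded_clinear)
  interpret S': bounded_linear "adj S"
    by (intro bounded_clinear_imp_bounded_linear bounded_clinear_adj bS)
  \<comment> \<open>After expansion, \<open>adj S (S x) = x\<close> cancels the identity, and every
    remaining term contains \<open>K\<close> or \<open>adj K\<close>.\<close>
  have "(\<lambda>x. x - adj (\<lambda>x. K x + S x) (K x + S x))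
      = (\<lambda>x. - (adj K (K x + S x) + adj S (K x)))"
    by (simp add: adj_add[OF bK bS] S'.add SS fun_eq_iff algebra_simps)
  moreover have "compact_operator \<dots>"
    by (intro compact_operator_uminus compact_operator_add
        compact_operator_compose_right[OF compact_operator_adj]
        compact_operator_compose_left[OF bounded_clinear_adj] bounded_clinear_add K bK bS)
  ultimately show ?thesis by simp
qed

text \<open>The isometry is the polar part \<open>U = T A\<^sup>-\<^sup>1\<close> with \<open>A = (T\<^sup>*T)\<^bsup>1/2\<^esup>\<close>; compactness of \<open>T - U = U (A - I)\<close>
  follows from \<open>I - T\<^sup>*T = (I - A) (I + A)\<close>.\<close>

lemma compact_perturbation_of_isometry:
  assumes T: "left_invertible T" and C: "compact_operator (\<lambda>x. x - adj T (T x))"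
  shows "\<exists>K S. compact_operator K \<and> isometry S \<and> T = (\<lambda>x. K x + S x)"
proof -
  have bT: "bounded_clinear T" using T by (simp add: left_invertible_def)
  have P: "bounded_clinear (\<lambda>x. adj T (T x))"
    by (rule bounded_clinear_compose[OF bounded_clinear_adj[OF bT] bT])
  have "self_adjoint (\<lambda>x. adj T (T x))"
    by (simp add: self_adjoint_def cinner_adj_left cinner_adj_right bT)
  then obtain A where A: "bounded_clinear A" "coercive A"
      "\<And>x y. cinner (A x) y = cinner x (A y)" "\<And>x. A (A x) = adj T (T x)"
    using coercive_square_root[OF P left_invertible_imp_coercive[OF T]]
    unfolding self_adjoint_def by blast
  interpret A: bounded_linear A using A(1) by (rule bounded_clinear_imp_bounded_linear)
  have bA': "bounded_clinear (inv A)"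
    by (rule bounded_clinear_inv_coercive[OF A(1,2)])
  have AA': "A (inv A x) = x" and A'A: "inv A (A x) = x" for x
    using coercive_bij[OF A(1,2)] by (auto simp: bij_def surj_f_inv_f)
  define U where "U x = T (inv A x)" for x
  have bU: "bounded_clinear U"
    unfolding U_def by (rule bounded_clinear_compose[OF bT bA'])
  interpret U: bounded_linear U using bU by (rule bounded_clinear_imp_bounded_linear)
  have "isometry U"
  proof (rule isometryI[OF bU])
    fix x y
    \<comment> \<open>Moving \<open>T\<close> across gives \<open>adj T \<circ> T\<close>, which is
      \<open>A\<close> squared; one \<open>A\<close> cancels \<open>inv A x\<close> and the other
      moves over to cancel \<open>inv A y\<close>.\<close>
    have "cinner (U x) (U y) = cinner (A (A (inv A x))) (inv A y)"
      by (simp only: U_def A(4) cinner_adj_left[OF bT])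
    also have "\<dots> = cinner x y" by (simp add: AA' A(3))
    finally show "cinner (U x) (U y) = cinner x y" .
  qed
  define N where "N x = x + A x" for x
  have N: "bounded_clinear N" "coercive N"
    unfolding N_def by (intro bounded_clinear_intros coercive_add_id A(1,2))+
  define C where "C x = x - adj T (T x)" for x
  \<comment> \<open>\<open>C\<close> equals \<open>(I - A) N\<close>, so composing with the bounded
    inverse of \<open>N\<close> on the right isolates \<open>I - A\<close> and passes compactness on
    to it.\<close>
  have "C (inv N x) = x - A x" for x
  proof -
    have "surj N" using coercive_bij[OF N] by (simp add: bij_def)
    then have "x = N (inv N x)" by (simp add: surj_f_inv_f)
    then have "x - A x = N (inv N x) - A (N (inv N x))" by simp
    also have "\<dots> = C (inv N x)" by (simp add: N_def C_def A.add A(4))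
    finally show ?thesis by simp
  qed
  moreover have "compact_operator (\<lambda>x. - U (C (inv N x)))"
    using C unfolding C_def[symmetric]
    by (rule compact_operator_uminus[OF compact_operator_compose_left[OF bU
          compact_operator_compose_right[OF _ bounded_clinear_inv_coercive[OF N]]]])
  ultimately have "compact_operator (\<lambda>x. - U (x - A x))" by simp
  moreover have "T x = - U (x - A x) + U x" for x
    by (simp add: U.diff) (simp add: U_def A'A)
  ultimately show ?thesis using \<open>isometry U\<close> by blast
qed

section \<open>Equivalence of the four conditions\<close>

theorem proposition2p1:
  fixes T :: "'a::complex_hilbert_space \<Rightarrow> 'a"
  assumes "separable_space (euclidean :: 'a topology)"
    and "bounded_clinear T"
    and "left_invertible T"
    and "finite_index T"
  shows "((\<exists>K S. compact_operator K \<and> isometry S \<and> T = (\<lambda>x. K x + S x))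
            \<longleftrightarrow> compact_operator (\<lambda>x. x - adj T (T x)))
       \<and> (compact_operator (\<lambda>x. x - adj T (T x))
            \<longleftrightarrow> compact_operator (\<lambda>x. canonical_left_inverse T x - adj T x))
       \<and> (compact_operator (\<lambda>x. canonical_left_inverse T x - adj T x)
            \<longleftrightarrow> compact_operator (\<lambda>x. x - T (adj T x)))"
proof -
  note T = \<open>bounded_clinear T\<close>
  define P where "P x = adj T (T x)" for x
  define L where "L = canonical_left_inverse T"
  have T': "bounded_clinear (adj T)" by (rule bounded_clinear_adj[OF T])
  interpret T: bounded_linear T using T by (rule bounded_clinear_imp_bounded_linear)
  interpret T': bounded_linear "adj T" using T' by (rule bounded_clinear_imp_bounded_linear)
  have P: "bounded_clinear P" "coercive P"
    unfolding P_def
    by (intro bounded_clinear_compose[OF T' T] left_invertible_imp_coercive assms)+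
  have bP': "bounded_clinear (inv P)" by (rule bounded_clinear_inv_coercive[OF P])
  interpret P': bounded_linear "inv P" using bP' by (rule bounded_clinear_imp_bounded_linear)
  have PP': "P (inv P x) = x" and P'P: "inv P (P x) = x" for x
    using coercive_bij[OF P] by (auto simp: bij_def surj_f_inv_f)
  have "adj T \<circ> T = P" by (auto simp: P_def)
  then have L: "L x = inv P (adj T x)" for x
    by (simp add: L_def canonical_left_inverse_def)
  have bL: "bounded_clinear L"
    unfolding L[abs_def] by (rule bounded_clinear_compose[OF bP' T'])
  interpret L: bounded_linear L using bL by (rule bounded_clinear_imp_bounded_linear)
  have LT: "L (T x) = x" for x using P'P by (simp add: L P_def)

  have "compact_operator (\<lambda>x. L x - adj T x)" if C: "compact_operator (\<lambda>x. x - P x)"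
  proof -
    have "L x - adj T x = inv P (adj T x - P (adj T x))" for x
      by (simp add: L P'.diff P'P)
    then show ?thesis
      using compact_operator_compose_left[OF bP' compact_operator_compose_right[OF C T']]
      by simp
  qed
  \<comment> \<open>Composition with \<open>T\<close> on the right turns \<open>L\<close> into the
    identity and \<open>adj T\<close> into \<open>P\<close>.\<close>
  moreover have "compact_operator (\<lambda>x. x - P x)" if C: "compact_operator (\<lambda>x. L x - adj T x)"
    using compact_operator_compose_right[OF C T] by (simp add: LT P_def)
  moreover have "compact_operator (\<lambda>x. L x - adj T x)"
    if C: "compact_operator (\<lambda>x. x - T (adj T x))"
    using compact_operator_compose_left[OF bL C] by (simp add: L.diff LT)
  moreover have "compact_operator (\<lambda>x. x - T (adj T x))"
    if C: "compact_operator (\<lambda>x. L x - adj T x)"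
  proof -
    \<comment> \<open>\<open>T L\<close> is the orthogonal projection onto the range of
      \<open>T\<close>, so \<open>I - T L\<close> maps into the kernel of \<open>adj T\<close>.
      Finite index makes that kernel finite-dimensional.\<close>
    have "adj T (x - T (L x)) = 0" for x
      using PP'[of "adj T x"] by (simp add: T'.diff L P_def)
    then have "range (\<lambda>x. x - T (L x)) \<subseteq> ker (adj T)"
      by (auto simp: ker_def)
    moreover have "cdim (ker (adj T)) < \<infinity>"
      using assms finite_index_left_invertible_iff by blast
    ultimately have "compact_operator (\<lambda>x. x - T (L x))"
      by (intro compact_operator_finite_rank bounded_clinear_diff bounded_clinear_id
          bounded_clinear_compose[OF T bL])
    \<comment> \<open>The terms \<open>T (L x)\<close> cancel in the sum of
      \<open>x - T (L x)\<close> and \<open>T (L x - adj T x)\<close>.\<close>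
    from compact_operator_add[OF this compact_operator_compose_left[OF T C]]
    show ?thesis by (simp add: T.diff)
  qed
  moreover have "(\<exists>K S. compact_operator K \<and> isometry S \<and> T = (\<lambda>x. K x + S x))
      \<longleftrightarrow> compact_operator (\<lambda>x. x - P x)"
    unfolding P_def
    using compact_perturbation_of_isometry_imp compact_perturbation_of_isometry assms(3) by blast
  ultimately show ?thesis unfolding P_def L_def by blast
qed

end
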